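(* Let $\mathcal{T}$ be a hierarchical T-mesh and let $\mathbf{r}=(r,r')$ be a constant smoothness distribution on $\mathcal{T}$. If $m\ge 2r+1$ and $m'\ge 2r'+1$, then $h_{m,m'}^{r,r'}(\mathcal{T})=0$.
   Context: T-mesh. A T-mesh $\mathcal{T}$ of $\mathbb{R}^2$ consists of a finite set $\mathcal{T}_2$ of closed axis-aligned rectangles (cells), a finite set $\mathcal{T}_1$ of closed axis-aligned segments (edges) contained in $\bigcup_{\sigma\in\mathcal{T}_2}\partial\sigma$, and the finite set $\mathcal{T}_0=\bigcup_{\tau\in\mathcal{T}_1}\partial\tau$ of end points of edges (vertices), such that: for $\sigma\in\mathcal{T}_2$, $\partial\sigma$ is a finite union of elements of $\mathcal{T}_1$; for $\sigma\ne\sigma'$ in $\mathcal{T}_2$, $\sigma\cap\sigma'=\partial\sigma\cap\partial\sigma'$ is a finite union of elements of $\mathcal{T}_1\cup\mathcal{T}_0$; for $\tau\neq\tau'$ in $\mathcal{T}_1$, $\tau\cap\tau'=\partial\tau\cap\partial\tau'\subset\mathcal{T}_0$. The domain is $\Omega=\bigcup_{\sigma\in\mathcal{T}_2}\sigma$, with interior $\Omega^\circ$. Edges parallel to the first axis are horizontal, those parallel to the second axis are vertical. Standing assumption: every vertex belongs to at least one horizontal edge and at least one vertical edge. A hierarchical T-mesh is a T-mesh which is either a single axis-aligned rectangle $\Omega$ (one cell), or is obtained from a hierarchical T-mesh by splitting a cell along a vertical or horizontal line. An edge is interior if it meets $\Omega^\circ$; $\mathcal{T}_1^o$ is the set of interior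 edges. A vertex is interior if it lies in $\Omega^\circ$; $\mathcal{T}_0^o$ is the set of interior vertices. Constant smoothness distribution $(r,r')$, $r,r'\in\mathbb{N}$ ($0\in\mathbb N$): $\mathbf{r}(\tau)=r$ for every vertical edge and $\mathbf{r}(\tau)=r'$ for every horizontal edge. The number $h$. With coordinates $(s,t)$, $R_{m,m'}$ is the space of polynomials in $\mathbb{R}[s,t]$ of degree $\le m$ in $s$ and $\le m'$ in $t$. For an edge $\tau$, let $l_\tau$ be a nonzero polynomial of degree 1 defining the line supporting $\tau$, $\Delta^{\mathbf{r}}(\tau)=l_\tau^{\mathbf{r}(\tau)+1}$, and $\mathfrak{I}^{\mathbf{r}}_{m,m'}(\tau)=(\Delta^{\mathbf{r}}(\tau))\cap R_{m,m'}$. For a vertex $\gamma$, $\mathfrak{I}^{\mathbf{r}}_{m,m'}(\gamma)=\mathfrak{I}^{\mathbf{r}}_{m,m'}(\tau_v)+\mathfrak{I}^{\mathbf{r}}_{m,m'}(\tau_h)$ for any vertical edge $\tau_v$ and horizontal edge $\tau_h$ containing $\gamma$. With a chosen orientation of each edge, let $$\partial_1:\bigoplus_{\tau\in\mathcal{T}_1^o}[\tau]\,\mathfrak{I}^{\mathbf{r}}_{m,m'}(\tau)\to\bigoplus_{\gamma\in\mathcal{T}_0^o}[\gamma]\,\mathfrak{I}^{\mathbf{r}}_{m,m'}(\gamma),\qquad [\tau]p\mapsto[\gamma_2]p-[\gamma_1]p$$ for $\tau$ oriented from $\gamma_1$ to $\gamma_2$, where $[\gamma]=0$ if $\gamma\notin\mathcal{T}_0^o$.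 Then $h_{m,m'}^{r,r'}(\mathcal{T})=h_{m,m'}^{\mathbf{r}}(\mathcal{T})$ is the dimension of the cokernel of $\partial_1$. *)

theory Defs
  imports
    "HOL-Analysis.Analysis"
    "HOL-Computational_Algebra.Polynomial"
    "HOL-Library.Function_Algebras"
begin

section \<open>T-meshes\<close>

type_synonym point = "real \<times> real"

definition rectangle :: "point set \<Rightarrow> bool" where
  "rectangle \<sigma> \<longleftrightarrow> (\<exists>a b c d. a < b \<and> c < d \<and> \<sigma> = {a..b} \<times> {c..d})"

definition horizontal :: "point set \<Rightarrow> bool" where
  "horizontal \<tau> \<longleftrightarrow> (\<exists>a b c. a < b \<and> \<tau> = {a..b} \<times> {c})"

definition vertical :: "point set \<Rightarrow> bool" where
  "vertical \<tau> \<longleftrightarrow> (\<exists>a c d. c < d \<and> \<tau> = {a} \<times> {c..d})"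

record mesh =
  cells :: "point set set"
  edges :: "point set set"

text \<open>
  The boundary of an edge, i.e. the set of its two end points, is its relative frontier; for
  cells the ordinary frontier is used.
\<close>

definition vertices :: "mesh \<Rightarrow> point set" where
  "vertices T = (\<Union>\<tau>\<in>edges T. rel_frontier \<tau>)"

definition domain :: "mesh \<Rightarrow> point set" where
  "domain T = \<Union>(cells T)"

text \<open>
  The last conjunct is the standing assumption that every vertex lies on a horizontal and on a
  vertical edge.
\<close>

definition tmesh :: "mesh \<Rightarrow> bool" where
  "tmesh T \<longleftrightarrow>
     finite (cells T) \<and> (\<forall>\<sigma>\<in>cells T. rectangle \<sigma>) \<and>
     finite (edges T) \<and> (\<forall>\<tau>\<in>edges T. horizontal \<tau> \<or> vertical \<tau>) \<and>
     (\<forall>\<tau>\<in>edges T. \<tau> \<subseteq> (\<Union>\<sigma>\<in>cells T. frontier \<sigma>)) \<and>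
     (\<forall>\<sigma>\<in>cells T. \<exists>F\<subseteq>edges T. frontier \<sigma> = \<Union>F) \<and>
     (\<forall>\<sigma>\<in>cells T. \<forall>\<sigma>'\<in>cells T. \<sigma> \<noteq> \<sigma>' \<longrightarrow>
        \<sigma> \<inter> \<sigma>' = frontier \<sigma> \<inter> frontier \<sigma>' \<and>
        (\<exists>F\<subseteq>edges T. \<exists>V\<subseteq>vertices T. \<sigma> \<inter> \<sigma>' = \<Union>F \<union> V)) \<and>
     (\<forall>\<tau>\<in>edges T. \<forall>\<tau>'\<in>edges T. \<tau> \<noteq> \<tau>' \<longrightarrow>
        \<tau> \<inter> \<tau>' = rel_frontier \<tau> \<inter> rel_frontier \<tau>') \<and>
     (\<forall>\<gamma>\<in>vertices T. (\<exists>\<tau>\<in>edges T. horizontal \<tau> \<and> \<gamma> \<in> \<tau>) \<and>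
                      (\<exists>\<tau>\<in>edges T. vertical \<tau> \<and> \<gamma> \<in> \<tau>))"

definition interior_edges :: "mesh \<Rightarrow> point set set" where
  "interior_edges T = {\<tau> \<in> edges T. \<tau> \<inter> interior (domain T) \<noteq> {}}"

definition interior_vertices :: "mesh \<Rightarrow> point set" where
  "interior_vertices T = vertices T \<inter> interior (domain T)"


section \<open>Hierarchical T-meshes\<close>

text \<open>
  \<open>cuts \<sigma> S \<sigma>1 \<sigma>2\<close>: a vertical or horizontal line through the interior of the rectangle \<open>\<sigma>\<close>
  meets it in the segment \<open>S\<close> and divides it into \<open>\<sigma>1\<close> and \<open>\<sigma>2\<close>.
\<close>

definition cuts :: "point set \<Rightarrow> point set \<Rightarrow> point set \<Rightarrow> point set \<Rightarrow> bool" where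
  "cuts \<sigma> S \<sigma>1 \<sigma>2 \<longleftrightarrow>
     (\<exists>a b c d. a < b \<and> c < d \<and> \<sigma> = {a..b} \<times> {c..d} \<and>
        ((\<exists>x. a < x \<and> x < b \<and> S = {x} \<times> {c..d} \<and>
              \<sigma>1 = {a..x} \<times> {c..d} \<and> \<sigma>2 = {x..b} \<times> {c..d}) \<or>
         (\<exists>y. c < y \<and> y < d \<and> S = {a..b} \<times> {y} \<and>
              \<sigma>1 = {a..b} \<times> {c..y} \<and> \<sigma>2 = {a..b} \<times> {y..d})))"

text \<open>An edge with \<open>p\<close> in its relative interior is replaced by its two halves.\<close>

definition subdivide :: "point \<Rightarrow> point set set \<Rightarrow> point set set" where
  "subdivide p E =
     {\<tau> \<in> E. p \<notin> rel_interior \<tau>} \<union>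
     {closed_segment q p | q \<tau>. \<tau> \<in> E \<and> p \<in> rel_interior \<tau> \<and> q \<in> rel_frontier \<tau>}"

text \<open>
  Splitting a cell adds the cut segment as an edge; each end point of the cut that is not yet a
  vertex subdivides the edge it lies on.
\<close>

definition splits_to :: "mesh \<Rightarrow> mesh \<Rightarrow> bool" where
  "splits_to T T' \<longleftrightarrow>
     (\<exists>\<sigma>\<in>cells T. \<exists>S \<sigma>1 \<sigma>2 p q. cuts \<sigma> S \<sigma>1 \<sigma>2 \<and> rel_frontier S = {p, q} \<and>
        cells T' = (cells T - {\<sigma>}) \<union> {\<sigma>1, \<sigma>2} \<and>
        edges T' = insert S (subdivide q (subdivide p (edges T))))"

inductive hierarchical_tmesh :: "mesh \<Rightarrow> bool" where
  single: "tmesh T \<Longrightarrow> cells T = {\<sigma>} \<Longrightarrow> hierarchical_tmesh T"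
| split: "hierarchical_tmesh T \<Longrightarrow> splits_to T T' \<Longrightarrow> tmesh T' \<Longrightarrow> hierarchical_tmesh T'"


section \<open>Ideals attached to edges and vertices\<close>

text \<open>
  \<open>\<real>[s,t]\<close> is represented as \<open>\<real>[s][t]\<close>: the coefficient of \<open>s ^ j * t ^ i\<close> in \<open>p\<close> is
  \<open>coeff (coeff p i) j\<close>.
\<close>

type_synonym bipoly = "real poly poly"

definition bideg_space :: "nat \<Rightarrow> nat \<Rightarrow> bipoly set" where
  "bideg_space m m' = {p. (\<forall>i. degree (coeff p i) \<le> m) \<and> degree p \<le> m'}"

text \<open>
  \<open>l = \<alpha> + \<beta> * s + \<delta> * t\<close> has degree 1 and vanishes on \<open>\<tau>\<close>. For an edge \<open>\<tau>\<close>, such an \<open>l\<close> exists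
  and is unique up to a nonzero constant factor.
\<close>

definition defines_line :: "bipoly \<Rightarrow> point set \<Rightarrow> bool" where
  "defines_line l \<tau> \<longleftrightarrow>
     (\<exists>\<alpha> \<beta> \<delta>. (\<beta> \<noteq> 0 \<or> \<delta> \<noteq> 0) \<and> l = [:[:\<alpha>, \<beta>:], [:\<delta>:]:] \<and>
        (\<forall>(s, t)\<in>\<tau>. \<alpha> + \<beta> * s + \<delta> * t = 0))"

text \<open>
  The argument \<open>\<rho>\<close> is the smoothness distribution. The ideal does not depend on the choice of
  \<open>l\<close>.
\<close>

definition edge_ideal :: "nat \<Rightarrow> nat \<Rightarrow> (point set \<Rightarrow> nat) \<Rightarrow> point set \<Rightarrow> bipoly set" where
  "edge_ideal m m' \<rho> \<tau> = {p \<in> bideg_space m m'. \<exists>l. defines_line l \<tau> \<and> l ^ (\<rho> \<tau> + 1) dvd p}"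

text \<open>
  All vertical edges through \<open>\<gamma>\<close> lie on one line, and so do all horizontal ones; hence for
  \<open>constant_smoothness\<close> the choice of the two edges is immaterial.
\<close>

definition vertex_ideal ::
    "mesh \<Rightarrow> nat \<Rightarrow> nat \<Rightarrow> (point set \<Rightarrow> nat) \<Rightarrow> point \<Rightarrow> bipoly set" where
  "vertex_ideal T m m' \<rho> \<gamma> =
     {p + q | p q \<tau>v \<tau>h. \<tau>v \<in> edges T \<and> vertical \<tau>v \<and> \<gamma> \<in> \<tau>v \<and> p \<in> edge_ideal m m' \<rho> \<tau>v \<and>
                          \<tau>h \<in> edges T \<and> horizontal \<tau>h \<and> \<gamma> \<in> \<tau>h \<and> q \<in> edge_ideal m m' \<rho> \<tau>h}"

definition constant_smoothness :: "nat \<Rightarrow> nat \<Rightarrow> point set \<Rightarrow> nat" where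
  "constant_smoothness r r' \<tau> = (if vertical \<tau> then r else r')"


section \<open>The boundary map and its cokernel\<close>

text \<open>The two direct sums, as functions vanishing outside the finite index set.\<close>

definition edge_chains ::
    "mesh \<Rightarrow> nat \<Rightarrow> nat \<Rightarrow> (point set \<Rightarrow> nat) \<Rightarrow> (point set \<Rightarrow> bipoly) set" where
  "edge_chains T m m' \<rho> =
     {f. (\<forall>\<tau>\<in>interior_edges T. f \<tau> \<in> edge_ideal m m' \<rho> \<tau>) \<and> (\<forall>\<tau>. \<tau> \<notin> interior_edges T \<longrightarrow> f \<tau> = 0)}"

definition vertex_chains ::
    "mesh \<Rightarrow> nat \<Rightarrow> nat \<Rightarrow> (point set \<Rightarrow> nat) \<Rightarrow> (point \<Rightarrow> bipoly) set" where
  "vertex_chains T m m' \<rho> =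
     {g. (\<forall>\<gamma>\<in>interior_vertices T. g \<gamma> \<in> vertex_ideal T m m' \<rho> \<gamma>) \<and>
         (\<forall>\<gamma>. \<gamma> \<notin> interior_vertices T \<longrightarrow> g \<gamma> = 0)}"

text \<open>\<open>ori \<tau> = (\<gamma>1, \<gamma>2)\<close> means that \<open>\<tau>\<close> is oriented from \<open>\<gamma>1\<close> to \<open>\<gamma>2\<close>.\<close>

definition orientation :: "mesh \<Rightarrow> (point set \<Rightarrow> point \<times> point) \<Rightarrow> bool" where
  "orientation T ori \<longleftrightarrow> (\<forall>\<tau>\<in>edges T. rel_frontier \<tau> = {fst (ori \<tau>), snd (ori \<tau>)})"

definition boundary1 ::
    "mesh \<Rightarrow> (point set \<Rightarrow> point \<times> point) \<Rightarrow> (point set \<Rightarrow> bipoly) \<Rightarrow> (point \<Rightarrow> bipoly)" where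
  "boundary1 T ori f =
     (\<lambda>\<gamma>. if \<gamma> \<in> interior_vertices T
           then \<Sum>\<tau>\<in>interior_edges T.
                  (if snd (ori \<tau>) = \<gamma> then f \<tau> else 0) - (if fst (ori \<tau>) = \<gamma> then f \<tau> else 0)
           else 0)"

definition chain_scale :: "real \<Rightarrow> (point \<Rightarrow> bipoly) \<Rightarrow> (point \<Rightarrow> bipoly)" where
  "chain_scale c g = (\<lambda>\<gamma>. smult [:c:] (g \<gamma>))"

text \<open>
  \<open>B\<close> is a finite set of representatives of the elements of a basis of \<open>V / W\<close>: modulo \<open>W\<close>, every
  element of \<open>V\<close> is a unique linear combination of \<open>B\<close>.
\<close>

definition quotient_basis ::
    "(real \<Rightarrow> 'v \<Rightarrow> 'v) \<Rightarrow> 'v::ab_group_add set \<Rightarrow> 'v set \<Rightarrow> 'v set \<Rightarrow> bool" where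
  "quotient_basis scl V W B \<longleftrightarrow> finite B \<and> B \<subseteq> V \<and>
     (\<forall>v\<in>V. \<exists>!c. (\<forall>b. b \<notin> B \<longrightarrow> c b = 0) \<and> v - (\<Sum>b\<in>B. scl (c b) b) \<in> W)"

text \<open>Nothing is asserted about this number if the quotient is infinite-dimensional.\<close>

definition quotient_dim :: "(real \<Rightarrow> 'v \<Rightarrow> 'v) \<Rightarrow> 'v::ab_group_add set \<Rightarrow> 'v set \<Rightarrow> nat" where
  "quotient_dim scl V W = (THE n. \<exists>B. quotient_basis scl V W B \<and> card B = n)"

definition h_dim ::
    "mesh \<Rightarrow> (point set \<Rightarrow> point \<times> point) \<Rightarrow> (point set \<Rightarrow> nat) \<Rightarrow> nat \<Rightarrow> nat \<Rightarrow> nat" where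
  "h_dim T ori \<rho> m m' =
     quotient_dim chain_scale (vertex_chains T m m' \<rho>)
       (boundary1 T ori ` edge_chains T m m' \<rho>)"

end

theory Submission
  imports Defs "HOL-Computational_Algebra.Polynomial_Factorial"
    "HOL-Computational_Algebra.Field_as_Ring"
begin

text \<open>
  By induction on the splits, every \<open>[\<gamma>]f\<close> with \<open>f\<close> in the ideal of one of the two lines through
  \<open>\<gamma>\<close> is a boundary. Subdividing an edge does not lose boundaries. At a new end point of the cut \<open>S\<close>,
  an element of the ideal of the subdivided edge is moved along half of that edge to an old vertex.
  For \<open>f\<close> in the ideal of \<open>S\<close>, the edges through the two ends \<open>p\<close>, \<open>q\<close> of \<open>S\<close> lie on distinct parallel
  lines, whose defining polynomials, raised to the power prescribed by the smoothness, are coprime.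
  The degree bound then allows one to write \<open>f = g + h\<close> with \<open>g\<close> also in the ideal at \<open>p\<close> and \<open>h\<close> in that
  at \<open>q\<close>. So \<open>[p]g\<close> and \<open>[q]h\<close> are boundaries, and \<open>[p]h\<close> and \<open>[q]h\<close> differ by the boundary of \<open>[S]h\<close>.
\<close>

section \<open>Axis-parallel segments\<close>

text \<open>With the direction as a Boolean, one argument covers both cases and
  \<open>\<not> v\<close> is the direction perpendicular to \<open>v\<close>.\<close>

definition parallel :: "bool \<Rightarrow> point set \<Rightarrow> bool" where
  "parallel v \<tau> \<longleftrightarrow> (if v then vertical \<tau> else horizontal \<tau>)"

text \<open>This is the coordinate that stays constant along a line of direction
  \<open>v\<close>.\<close>

definition axis_coord :: "bool \<Rightarrow> point \<Rightarrow> real" where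
  "axis_coord v \<gamma> = (if v then fst \<gamma> else snd \<gamma>)"

lemma closed_segment_horizontal:
  fixes a b c :: real
  assumes "a \<le> b"
  shows "closed_segment (a, c) (b, c) = {a..b} \<times> {c}"
proof -
  have "closed_segment (a, c) (b, c) = (\<lambda>x. (x, c)) ` closed_segment a b"
    by (simp add: closed_segment_image_interval image_image algebra_simps)
  then show ?thesis
    using assms by (auto simp: closed_segment_eq_real_ivl)
qed

lemma closed_segment_vertical:
  fixes a c d :: real
  assumes "c \<le> d"
  shows "closed_segment (a, c) (a, d) = {a} \<times> {c..d}"
proof -
  have "closed_segment (a, c) (a, d) = (\<lambda>x. (a, x)) ` closed_segment c d"
    by (simp add: closed_segment_image_interval image_image algebra_simps)
  then show ?thesis
    using assms by (auto simp: closed_segment_eq_real_ivl)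
qed

text \<open>Passing from intervals to end points treats both directions alike and makes the general
  facts about \<open>closed_segment\<close> applicable.\<close>

lemma parallel_iff:
  "parallel v \<tau> \<longleftrightarrow> (\<exists>a b. a \<noteq> b \<and> axis_coord v a = axis_coord v b \<and> \<tau> = closed_segment a b)"
proof
  assume "parallel v \<tau>"
  then show "\<exists>a b. a \<noteq> b \<and> axis_coord v a = axis_coord v b \<and> \<tau> = closed_segment a b"
  proof (cases v)
    case True
    with \<open>parallel v \<tau>\<close> obtain a c d where "c < d" "\<tau> = {a} \<times> {c..d}"
      by (auto simp: parallel_def vertical_def)
    then show ?thesis
      using True closed_segment_vertical[of c d a]
      by (intro exI[of _ "(a, c)"] exI[of _ "(a, d)"]) (auto simp: axis_coord_def)
  next
    case False
    with \<open>parallel v \<tau>\<close> obtain a b c where "a < b" "\<tau> = {a..b} \<times> {c}"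
      by (auto simp: parallel_def horizontal_def)
    then show ?thesis
      using False closed_segment_horizontal[of a b c]
      by (intro exI[of _ "(a, c)"] exI[of _ "(b, c)"]) (auto simp: axis_coord_def)
  qed
next
  have *: "parallel v (closed_segment (x, y) (x', y'))"
    if "(x, y) \<noteq> (x', y')" "axis_coord v (x, y) = axis_coord v (x', y')" "x \<le> x'" "y \<le> y'"
    for x y x' y' :: real
    using that closed_segment_vertical[of y y' x] closed_segment_horizontal[of x x' y]
    by (cases v) (auto simp: parallel_def vertical_def horizontal_def axis_coord_def
        order.order_iff_strict)
  assume "\<exists>a b. a \<noteq> b \<and> axis_coord v a = axis_coord v b \<and> \<tau> = closed_segment a b"
  then obtain x y x' y' where
    h: "(x, y) \<noteq> (x', y')" "axis_coord v (x, y) = axis_coord v (x', y')"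
       "\<tau> = closed_segment (x, y) (x', y')"
    by (metis surj_pair)
  \<comment> \<open>Points that share a coordinate are comparable componentwise, so up to exchanging
    the ends the sorted case \<open>*\<close> applies.\<close>
  then have "x \<le> x' \<and> y \<le> y' \<or> x' \<le> x \<and> y' \<le> y"
    by (auto simp: axis_coord_def split: if_splits)
  then show "parallel v \<tau>"
    using h *[of x y x' y'] *[of x' y' x y] closed_segment_commute[of "(x, y)" "(x', y')"] by metis
qed

lemma rel_frontier_closed_segment: "rel_frontier (closed_segment a b) = (if a = b then {} else {a, b})"
  for a b :: "'a::euclidean_space"
  by (auto simp: rel_frontier_def rel_interior_closed_segment open_segment_def)

lemma axis_coord_closed_segment:
  assumes "axis_coord v a = axis_coord v b" "p \<in> closed_segment a b"
  shows "axis_coord v p = axis_coord v a"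
proof -
  obtain u where "p = (1 - u) *\<^sub>R a + u *\<^sub>R b"
    using assms(2) by (auto simp: closed_segment_def)
  then have "axis_coord v p = (1 - u) * axis_coord v a + u * axis_coord v b"
    by (simp add: axis_coord_def)
  then show ?thesis
    using assms(1) by (simp add: algebra_simps)
qed

lemma parallel_axis_coord:
  assumes "parallel v \<tau>" "p \<in> \<tau>" "q \<in> \<tau>"
  shows "axis_coord v p = axis_coord v q"
  using assms axis_coord_closed_segment unfolding parallel_iff by metis

text \<open>Otherwise both coordinates would be constant, although the two end points are
  distinct.\<close>

lemma parallel_not_both:
  assumes "parallel v \<tau>"
  shows "\<not> parallel (\<not> v) \<tau>"
proof
  assume *: "parallel (\<not> v) \<tau>"
  obtain a b where ab: "a \<noteq> b" "\<tau> = closed_segment a b"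
    using assms unfolding parallel_iff by blast
  have "axis_coord w a = axis_coord w b" if "w = v \<or> w = (\<not> v)" for w
    using assms * that parallel_axis_coord[of w \<tau> a b] ab by auto
  then have "fst a = fst b" "snd a = snd b"
    by (metis (full_types) axis_coord_def)+
  with ab show False by (simp add: prod_eq_iff)
qed

text \<open>A nondegenerate segment inside a perpendicular one would have both coordinates constant,
  so the two directions agree.\<close>

lemma parallel_subset:
  assumes "parallel v \<tau>'" "\<tau>' \<subseteq> \<tau>" "parallel w \<tau>"
  shows "parallel v \<tau>"
proof (cases "w = v")
  case False
  obtain a b where ab: "a \<noteq> b" "\<tau>' = closed_segment a b" "axis_coord v a = axis_coord v b"
    using assms(1) unfolding parallel_iff by blast
  then have "axis_coord w a = axis_coord w b"
    using assms(2,3) parallel_axis_coord[of w \<tau> a b] by auto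
  then have "fst a = fst b" "snd a = snd b"
    using ab(3) False by (auto simp: axis_coord_def split: if_splits)
  then show ?thesis using ab(1) by (simp add: prod_eq_iff)
qed (use assms in simp)

lemma parallel_rel_frontier:
  assumes "parallel v \<tau>"
  obtains a b where "a \<noteq> b" "\<tau> = closed_segment a b" "rel_frontier \<tau> = {a, b}"
    "rel_interior \<tau> = \<tau> - {a, b}"
  using assms unfolding parallel_iff
  by (metis open_segment_def rel_frontier_closed_segment rel_interior_closed_segment)

section \<open>Subdivision of edges at a point\<close>

lemma parallel_half:
  assumes "parallel v \<tau>" "p \<in> rel_interior \<tau>" "a \<in> rel_frontier \<tau>"
  shows "parallel v (closed_segment a p)" "closed_segment a p \<subseteq> \<tau>"
    "rel_frontier (closed_segment a p) = {a, p}"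
proof -
  obtain b c where bc: "b \<noteq> c" "\<tau> = closed_segment b c" "rel_frontier \<tau> = {b, c}"
    "rel_interior \<tau> = \<tau> - {b, c}"
    using parallel_rel_frontier[OF assms(1)] by metis
  then have "a \<in> \<tau>" "p \<in> \<tau>" "a \<noteq> p"
    using assms by auto
  then show "closed_segment a p \<subseteq> \<tau>" "rel_frontier (closed_segment a p) = {a, p}"
    using bc(2) by (auto simp: subset_closed_segment rel_frontier_closed_segment)
  show "parallel v (closed_segment a p)"
    using parallel_axis_coord[OF assms(1) \<open>a \<in> \<tau>\<close> \<open>p \<in> \<tau>\<close>] \<open>a \<noteq> p\<close> unfolding parallel_iff by blast
qed

lemma parallel_subdivide:
  assumes "\<forall>\<tau>\<in>E. \<exists>v. parallel v \<tau>"
  shows "\<forall>\<tau>\<in>subdivide p E. \<exists>v. parallel v \<tau>"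
  using assms parallel_half(1) unfolding subdivide_def by blast

text \<open>Each piece lies in an edge of \<open>E\<close> and fixes its direction. This traces
  edges of a subdivided mesh back to the mesh before it.\<close>

lemma subdivide_parallel_parent:
  assumes "\<forall>\<tau>\<in>E. \<exists>v. parallel v \<tau>" "\<tau>' \<in> subdivide p E" "parallel v \<tau>'"
  obtains \<tau> where "\<tau> \<in> E" "parallel v \<tau>" "\<tau>' \<subseteq> \<tau>"
proof -
  have "\<exists>\<tau>\<in>E. \<tau>' \<subseteq> \<tau>"
    using assms(1,2) parallel_half(2) unfolding subdivide_def by blast
  then show ?thesis
    using that assms(1,3) parallel_subset by meson
qed

lemma rel_frontier_subdivide:
  assumes "\<forall>\<tau>\<in>E. \<exists>v. parallel v \<tau>"
  shows "\<Union> (rel_frontier ` subdivide p E) \<subseteq> insert p (\<Union> (rel_frontier ` E))"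
proof
  fix x
  assume "x \<in> \<Union> (rel_frontier ` subdivide p E)"
  then consider \<tau> where "\<tau> \<in> E" "x \<in> rel_frontier \<tau>"
    | q \<tau> where "\<tau> \<in> E" "p \<in> rel_interior \<tau>" "q \<in> rel_frontier \<tau>"
        "x \<in> rel_frontier (closed_segment q p)"
    by (auto simp: subdivide_def)
  then show "x \<in> insert p (\<Union> (rel_frontier ` E))"
  proof cases
    case 2
    then have "x \<in> {q, p}"
      using assms parallel_half(3) by metis
    then show ?thesis
      using 2 by auto
  qed auto
qed


section \<open>The ideals of axis-parallel lines\<close>

text \<open>The variable \<open>s\<close> lives in the coefficients and \<open>t\<close> is the
  outer variable: the two cases are \<open>s - c\<close> and \<open>t - c\<close>.\<close>

definition line_poly :: "bool \<Rightarrow> real \<Rightarrow> bipoly" where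
  "line_poly v c = (if v then [:[:-c, 1:]:] else [:[:-c:], 1:])"

text \<open>The ideal is attached to the line through \<open>\<gamma>\<close> of direction
  \<open>v\<close> rather than to an edge, so that it is shared by all edges on that line and
  survives subdivision.\<close>

definition line_ideal :: "nat \<Rightarrow> nat \<Rightarrow> nat \<Rightarrow> nat \<Rightarrow> bool \<Rightarrow> point \<Rightarrow> bipoly set" where
  "line_ideal m m' r r' v \<gamma> =
     {p \<in> bideg_space m m'. line_poly v (axis_coord v \<gamma>) ^ ((if v then r else r') + 1) dvd p}"

text \<open>Comparing the values of a linear form at the two ends of the edge kills the coefficient
  of the varying coordinate; one scalar remains free.\<close>

lemma defines_line_parallel:
  assumes "parallel v \<tau>" "\<gamma> \<in> \<tau>"
  shows "defines_line l \<tau> \<longleftrightarrow> (\<exists>k. k \<noteq> 0 \<and> l = smult [:k:] (line_poly v (axis_coord v \<gamma>)))"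
proof -
  obtain x y where \<gamma>: "\<gamma> = (x, y)" by fastforce
  show ?thesis
  proof (cases v)
    case True
    with assms obtain c d where cd: "c < d" "\<tau> = {x} \<times> {c..d}"
      by (auto simp: parallel_def vertical_def \<gamma>)
    have "(\<forall>(s, t)\<in>\<tau>. \<alpha> + \<beta> * s + \<delta> * t = 0) \<longleftrightarrow> \<delta> = 0 \<and> \<alpha> = - \<beta> * x" for \<alpha> \<beta> \<delta>
    proof
      assume "\<forall>(s, t)\<in>\<tau>. \<alpha> + \<beta> * s + \<delta> * t = 0"
      then have "\<alpha> + \<beta> * x + \<delta> * c = 0" "\<alpha> + \<beta> * x + \<delta> * d = 0"
        using cd by auto
      then have "\<delta> * d = \<delta> * c" by linarith
      then show "\<delta> = 0 \<and> \<alpha> = - \<beta> * x"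
        using cd \<open>\<alpha> + \<beta> * x + \<delta> * c = 0\<close> by auto
    qed (use cd in auto)
    then show ?thesis
      using True by (auto simp: defines_line_def line_poly_def axis_coord_def \<gamma>)
  next
    case False
    with assms obtain a b where ab: "a < b" "\<tau> = {a..b} \<times> {y}"
      by (auto simp: parallel_def horizontal_def \<gamma>)
    have "(\<forall>(s, t)\<in>\<tau>. \<alpha> + \<beta> * s + \<delta> * t = 0) \<longleftrightarrow> \<beta> = 0 \<and> \<alpha> = - \<delta> * y" for \<alpha> \<beta> \<delta>
    proof
      assume "\<forall>(s, t)\<in>\<tau>. \<alpha> + \<beta> * s + \<delta> * t = 0"
      then have "\<alpha> + \<beta> * a + \<delta> * y = 0" "\<alpha> + \<beta> * b + \<delta> * y = 0"
        using ab by auto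
      then have "\<beta> * b = \<beta> * a" by linarith
      then show "\<beta> = 0 \<and> \<alpha> = - \<delta> * y"
        using ab \<open>\<alpha> + \<beta> * a + \<delta> * y = 0\<close> by auto
    qed (use ab in auto)
    then show ?thesis
      using False by (auto simp: defines_line_def line_poly_def axis_coord_def \<gamma>)
  qed
qed

text \<open>All polynomials defining the line differ by nonzero constants, which are units and do
  not affect divisibility.\<close>

lemma edge_ideal_eq:
  assumes "parallel v \<tau>" "\<gamma> \<in> \<tau>"
  shows "edge_ideal m m' (constant_smoothness r r') \<tau> = line_ideal m m' r r' v \<gamma>"
proof -
  have \<rho>: "constant_smoothness r r' \<tau> = (if v then r else r')"
    using parallel_not_both[OF assms(1)] assms(1)
    by (auto simp: constant_smoothness_def parallel_def split: if_splits)
  have unit: "smult [:k:] l ^ n dvd p \<longleftrightarrow> l ^ n dvd p" if "k \<noteq> 0" for k :: real and l p :: bipoly and n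
  proof -
    have "is_unit ([:[:k:]:] ^ n)"
      using that by (simp add: is_unit_power_iff is_unit_const_poly_iff dvd_field_iff)
    moreover have "smult [:k:] l ^ n = [:[:k:]:] ^ n * l ^ n"
      by (simp flip: power_mult_distrib)
    ultimately show ?thesis
      by (simp add: mult_unit_dvd_iff')
  qed
  let ?L = "line_poly v (axis_coord v \<gamma>)"
  have "(\<exists>l. (\<exists>k. k \<noteq> 0 \<and> l = smult [:k:] ?L) \<and> l ^ n dvd p) \<longleftrightarrow> ?L ^ n dvd p" for n and p :: bipoly
  proof
    assume "?L ^ n dvd p"
    then have "smult [:1:] ?L ^ n dvd p"
      by (simp only: unit zero_neq_one[symmetric] not_False_eq_True)
    then show "\<exists>l. (\<exists>k. k \<noteq> 0 \<and> l = smult [:k:] ?L) \<and> l ^ n dvd p"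
      by (intro exI[of _ "smult [:1:] ?L"] conjI exI[of _ 1]) simp_all
  qed (auto simp: unit)
  then show ?thesis
    by (simp only: edge_ideal_def line_ideal_def \<rho> defines_line_parallel[OF assms])
qed


section \<open>Splitting polynomials between two parallel lines\<close>

text \<open>A common divisor of the linear factors divides their difference, the nonzero constant
  \<open>d - c\<close>; coprimality then passes to powers.\<close>

lemma coprime_linear_powers:
  fixes c d :: real
  assumes "c \<noteq> d"
  shows "coprime ([:- c, 1:] ^ i) ([:- d, 1:] ^ j)"
proof -
  have "coprime [:- c, 1:] [:- d, 1:]"
  proof (rule coprimeI)
    fix q :: "real poly"
    assume "q dvd [:- c, 1:]" "q dvd [:- d, 1:]"
    then have "q dvd [:- c, 1:] - [:- d, 1:]"
      by (rule dvd_diff)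
    moreover have "is_unit ([:- c, 1:] - [:- d, 1:])"
      using assms by (simp add: is_unit_triv)
    ultimately show "is_unit q"
      by (rule dvd_trans)
  qed
  then show ?thesis
    by (metis coprime_power_left_iff coprime_power_right_iff)
qed

text \<open>Bezout gives \<open>p = p * a * A + p * b * B\<close>. Replacing \<open>p * b\<close> by
  its remainder \<open>R\<close> modulo \<open>A\<close> changes the second summand by a multiple of
  \<open>A * B\<close> only and bounds its degree; \<open>u\<close> is
  \<open>p - R * B\<close>.\<close>

lemma coprime_split:
  fixes A B p :: "real poly"
  assumes "coprime A B" "A \<noteq> 0" "degree p \<le> n" "degree A + degree B \<le> n + 1"
  obtains u where "A dvd u" "B dvd p - u" "degree u \<le> n"
proof -
  obtain a b where ab: "a * A + b * B = 1"
    using bezout_coefficients_fst_snd[of A B] assms(1) by (metis coprime_imp_gcd_eq_1)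
  define R where "R = (p * b) mod A"
  have "degree (R * B) \<le> n"
  proof (cases "R = 0")
    case False
    \<comment> \<open>The strict inequality absorbs the 1 in
      \<open>degree A + degree B \<le> n + 1\<close>.\<close>
    then have "degree R < degree A"
      unfolding R_def using degree_mod_less'[OF assms(2)] by blast
    then show ?thesis
      using degree_mult_le[of R B] assms(4) by linarith
  qed simp
  moreover have "p - R * B = p * a * A + (p * b - R) * B"
  proof -
    have "p = p * (a * A + b * B)" by (simp add: ab)
    then show ?thesis by (simp add: algebra_simps)
  qed
  moreover have "A dvd p * b - R"
    unfolding R_def by (simp add: dvd_minus_mod)
  ultimately have "A dvd p - R * B" "degree (p - R * B) \<le> n"
    using assms(3) by (simp, metis degree_diff_le)
  then show ?thesis
    using that[of "p - R * B"] by simp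
qed

text \<open>The bound on \<open>n\<close> says exactly that the two powers have total degree
  \<open>2 * (k + 1) \<le> n + 1\<close>. This is where the degree hypotheses of the theorem
  enter.\<close>

lemma monom_split:
  fixes c d :: real
  assumes "c \<noteq> d" "2 * k + 1 \<le> n"
  shows "\<exists>P. \<forall>j\<le>n. [:- c, 1:] ^ (k + 1) dvd P j \<and>
    [:- d, 1:] ^ (k + 1) dvd monom 1 j - P j \<and> degree (P j) \<le> n"
proof -
  have "\<exists>u. [:- c, 1:] ^ (k + 1) dvd u \<and> [:- d, 1:] ^ (k + 1) dvd monom 1 j - u \<and> degree u \<le> n"
    if "j \<le> n" for j
  proof -
    have "degree (monom (1::real) j) \<le> n"
      using that by (simp add: degree_monom_eq)
    moreover have "degree ([:- c, 1:] ^ (k + 1)) + degree ([:- d, 1:] ^ (k + 1)) \<le> n + 1"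
      using assms(2) by (simp only: degree_linear_power)
    ultimately show ?thesis
      using coprime_split[OF coprime_linear_powers[OF assms(1)]] power_not_zero pCons_eq_0_iff
      by (metis one_neq_zero)
  qed
  then show ?thesis
    by metis
qed

section \<open>Extending the splitting to two variables\<close>

definition lift_poly :: "real poly \<Rightarrow> real poly poly" where
  "lift_poly = map_poly (\<lambda>a. [:a:])"

lemma coeff_lift_poly: "coeff (lift_poly p) i = [:coeff p i:]"
  by (simp add: lift_poly_def coeff_map_poly)

lemma sum_const_poly: "(\<Sum>i\<in>I. [:f i:]) = [:\<Sum>i\<in>I. f i:]"
  by (induction I rule: infinite_finite_induct) auto

lemma lift_poly_mult: "lift_poly (p * q) = lift_poly p * lift_poly q"
  by (rule poly_eqI) (simp add: coeff_lift_poly coeff_mult sum_const_poly mult.commute)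

lemma lift_poly_power: "lift_poly (p ^ n) = lift_poly p ^ n"
proof (induction n)
  case 0
  show ?case by (simp add: lift_poly_def map_poly_1')
qed (simp add: lift_poly_mult)

text \<open>\<open>lift_poly\<close> is the multiplicative embedding of \<real>[t] into
  \<real>[s][t], so a factorization carries over.\<close>

lemma lift_poly_linear_power_dvd:
  assumes "[:- c, 1:] ^ n dvd p"
  shows "[:[:- c:], 1:] ^ n dvd lift_poly p"
proof -
  have "lift_poly [:- c, 1:] = [:[:- c:], 1:]"
    by (simp add: lift_poly_def map_poly_pCons one_pCons)
  then show ?thesis
    using assms lift_poly_mult lift_poly_power by (metis dvd_def)
qed

text \<open>
  Splitting only the monomials and extending linearly keeps the degree and the divisibility in the
  other variable.
\<close>

lemma split_outer:
  fixes f :: bipoly and c d :: real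
  assumes "c \<noteq> d" "2 * k + 1 \<le> m'" "f \<in> bideg_space m m'" "[:A:] dvd f"
  obtains g where "g \<in> bideg_space m m'" "[:A:] dvd g"
    "[:[:- c:], 1:] ^ (k + 1) dvd g" "[:[:- d:], 1:] ^ (k + 1) dvd f - g"
proof -
  obtain P where P: "\<And>j. j \<le> m' \<Longrightarrow> [:- c, 1:] ^ (k + 1) dvd P j"
    "\<And>j. j \<le> m' \<Longrightarrow> [:- d, 1:] ^ (k + 1) dvd monom 1 j - P j"
    "\<And>j. j \<le> m' \<Longrightarrow> degree (P j) \<le> m'"
    using monom_split[OF assms(1,2)] by auto
  define g where "g = (\<Sum>i\<le>m'. smult (coeff f i) (lift_poly (P i)))"
  have deg: "degree f \<le> m'" "\<And>i. degree (coeff f i) \<le> m"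
    using assms(3) by (auto simp: bideg_space_def)
  \<comment> \<open>The coefficients of \<open>g\<close> are real linear combinations of those of
    \<open>f\<close>; hence they inherit the bound \<open>m\<close> and the divisor
    \<open>A\<close>.\<close>
  have cg: "coeff g j = (\<Sum>i\<le>m'. smult (coeff (P i) j) (coeff f i))" for j
    by (simp add: g_def coeff_sum coeff_lift_poly)
  have "degree (coeff g j) \<le> m" for j
    unfolding cg using deg(2) by (intro degree_sum_le) (auto intro: order.trans[OF degree_smult_le])
  moreover have "degree g \<le> m'"
    unfolding g_def
  proof (intro degree_sum_le)
    fix i assume "i \<in> {..m'}"
    then have "degree (lift_poly (P i)) \<le> m'"
      using P(3)[of i] by (intro degree_le) (auto simp: coeff_lift_poly coeff_eq_0)
    then show "degree (smult (coeff f i) (lift_poly (P i))) \<le> m'"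
      using degree_smult_le order.trans by blast
  qed simp
  ultimately have "g \<in> bideg_space m m'"
    by (simp add: bideg_space_def)
  moreover have "[:A:] dvd g"
    using assms(4) by (auto simp: const_poly_dvd_iff cg intro!: dvd_sum dvd_smult)
  moreover have "[:[:- c:], 1:] ^ (k + 1) dvd g"
    unfolding g_def using P(1) by (intro dvd_sum dvd_smult lift_poly_linear_power_dvd) auto
  moreover have "[:[:- d:], 1:] ^ (k + 1) dvd f - g"
  proof -
    have "f = (\<Sum>i\<le>m'. smult (coeff f i) (lift_poly (monom 1 i)))"
      using poly_as_sum_of_monoms'[OF deg(1)]
      by (simp add: lift_poly_def map_poly_monom smult_monom flip: one_pCons)
    then have "f - g = (\<Sum>i\<le>m'. smult (coeff f i) (lift_poly (monom 1 i)))
        - (\<Sum>i\<le>m'. smult (coeff f i) (lift_poly (P i)))"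
      using g_def by argo
    also have "\<dots> = (\<Sum>i\<le>m'. smult (coeff f i) (lift_poly (monom 1 i - P i)))"
      unfolding sum_subtractf[symmetric]
      by (rule sum.cong) (auto intro!: poly_eqI simp: coeff_lift_poly smult_diff_left)
    finally show ?thesis
      using P(2) by (auto intro!: dvd_sum dvd_smult lift_poly_linear_power_dvd simp del: power_Suc)
  qed
  ultimately show ?thesis
    by (rule that)
qed

text \<open>A real-linear map applied to the coefficients commutes with multiplication by
  \<open>t + b\<close>, because \<open>b\<close> is a real number.\<close>

lemma map_poly_linear_power_dvd:
  fixes L :: "real poly \<Rightarrow> real poly"
  assumes add: "\<And>p q. L (p + q) = L p + L q" and smult: "\<And>a p. L (smult a p) = smult a (L p)"
    and "[:[:b:], 1:] ^ n dvd f"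
  shows "[:[:b:], 1:] ^ n dvd map_poly L f"
proof -
  have L0: "L 0 = 0"
    using smult[of 0 0] by simp
  have step: "map_poly L ([:[:b:], 1:] * u) = [:[:b:], 1:] * map_poly L u" for u
  proof (rule poly_eqI)
    show "coeff (map_poly L ([:[:b:], 1:] * u)) i = coeff ([:[:b:], 1:] * map_poly L u) i" for i
      by (cases i) (simp_all add: coeff_map_poly L0 add smult)
  qed
  have "map_poly L ([:[:b:], 1:] ^ n * u) = [:[:b:], 1:] ^ n * map_poly L u" for u
    by (induction n) (simp_all only: power_0 power_Suc mult_1 mult.assoc step)
  then show ?thesis
    using assms(3) by (auto elim!: dvdE)
qed

text \<open>Here the powers of \<open>s\<close> are split, and the linear extension \<open>L\<close>
  acts on each coefficient separately. Linearity preserves the power of \<open>t + b\<close>, and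
  divisibility by polynomials in \<open>s\<close> is tested coefficientwise.\<close>

lemma split_inner:
  fixes f :: bipoly and c d :: real
  assumes "c \<noteq> d" "2 * k + 1 \<le> m" "f \<in> bideg_space m m'" "[:[:b:], 1:] ^ n dvd f"
  obtains g where "g \<in> bideg_space m m'" "[:[:b:], 1:] ^ n dvd g"
    "[:[:- c, 1:] ^ (k + 1):] dvd g" "[:[:- d, 1:] ^ (k + 1):] dvd f - g"
proof -
  obtain P where P: "\<And>j. j \<le> m \<Longrightarrow> [:- c, 1:] ^ (k + 1) dvd P j"
    "\<And>j. j \<le> m \<Longrightarrow> [:- d, 1:] ^ (k + 1) dvd monom 1 j - P j"
    "\<And>j. j \<le> m \<Longrightarrow> degree (P j) \<le> m"
    using monom_split[OF assms(1,2)] by auto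
  define L where "L p = (\<Sum>j\<le>m. smult (coeff p j) (P j))" for p
  have L0: "L 0 = 0"
    by (simp add: L_def)
  have deg: "degree f \<le> m'" "\<And>i. degree (coeff f i) \<le> m"
    using assms(3) by (auto simp: bideg_space_def)
  have "degree (L p) \<le> m" for p
    unfolding L_def using P(3) by (intro degree_sum_le) (auto intro: order.trans[OF degree_smult_le])
  moreover have "degree (map_poly L f) \<le> m'"
    using deg(1) by (intro degree_le) (auto simp: coeff_map_poly coeff_eq_0 L0)
  ultimately have "map_poly L f \<in> bideg_space m m'"
    by (simp add: bideg_space_def coeff_map_poly L0)
  moreover have "[:[:b:], 1:] ^ n dvd map_poly L f"
  proof (rule map_poly_linear_power_dvd[OF _ _ assms(4)])
    show "L (smult a p) = smult a (L p)" for a p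
      using sum_distrib_left[of "[:a:]" "\<lambda>j. smult (coeff p j) (P j)" "{..m}"] by (simp add: L_def mult.commute)
  qed (simp add: L_def smult_add_left sum.distrib)
  moreover have "[:[:- c, 1:] ^ (k + 1):] dvd map_poly L f"
    unfolding const_poly_dvd_iff coeff_map_poly[of L, OF L0] L_def
    using P(1) by (intro allI dvd_sum dvd_smult) auto
  moreover have "[:[:- d, 1:] ^ (k + 1):] dvd f - map_poly L f"
    unfolding const_poly_dvd_iff coeff_diff coeff_map_poly[of L, OF L0]
  proof
    fix i
    have "coeff f i = (\<Sum>j\<le>m. smult (coeff (coeff f i) j) (monom 1 j))"
      using poly_as_sum_of_monoms'[OF deg(2)[of i]] by (simp add: smult_monom)
    then have "coeff f i - L (coeff f i) = (\<Sum>j\<le>m. smult (coeff (coeff f i) j) (monom 1 j))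
        - (\<Sum>j\<le>m. smult (coeff (coeff f i) j) (P j))"
      using L_def[of "coeff f i"] by argo
    also have "\<dots> = (\<Sum>j\<le>m. smult (coeff (coeff f i) j) (monom 1 j - P j))"
      by (simp add: smult_diff_right sum_subtractf)
    finally show "[:- d, 1:] ^ (k + 1) dvd coeff f i - L (coeff f i)"
      using P(2) by (auto intro!: dvd_sum dvd_smult simp del: power_Suc)
  qed
  ultimately show ?thesis
    by (rule that)
qed

section \<open>Splitting within the line ideals\<close>

lemma line_ideal_diff:
  assumes "f \<in> line_ideal m m' r r' v \<gamma>" "g \<in> line_ideal m m' r r' v \<gamma>"
  shows "f - g \<in> line_ideal m m' r r' v \<gamma>"
  using assms by (auto simp: line_ideal_def bideg_space_def intro: degree_diff_le dvd_diff)

lemma zero_in_line_ideal: "0 \<in> line_ideal m m' r r' v \<gamma>"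
  by (simp add: line_ideal_def bideg_space_def)

lemma line_ideal_cong:
  assumes "axis_coord v p = axis_coord v q"
  shows "line_ideal m m' r r' v p = line_ideal m m' r r' v q"
  using assms by (simp add: line_ideal_def)

text \<open>The lines of direction \<open>\<not> v\<close> through \<open>p\<close> and
  \<open>q\<close> are given by the variable that does not occur in the generator for
  \<open>v\<close>. Splitting in that variable, \<open>t\<close> if \<open>v\<close> is vertical and
  \<open>s\<close> otherwise, therefore stays in the ideal for \<open>v\<close>.\<close>

lemma line_ideal_split:
  assumes "m \<ge> 2 * r + 1" "m' \<ge> 2 * r' + 1"
    and "axis_coord (\<not> v) p \<noteq> axis_coord (\<not> v) q"
    and "f \<in> line_ideal m m' r r' v p"
  obtains g where "g \<in> line_ideal m m' r r' v p" "g \<in> line_ideal m m' r r' (\<not> v) p"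
    "f - g \<in> line_ideal m m' r r' (\<not> v) q"
proof -
  have "\<exists>g. g \<in> line_ideal m m' r r' v p \<and> g \<in> line_ideal m m' r r' (\<not> v) p \<and>
    line_poly (\<not> v) (axis_coord (\<not> v) q) ^ ((if \<not> v then r else r') + 1) dvd f - g"
  proof (cases v)
    case True
    then have "f \<in> bideg_space m m'" "[:[:- axis_coord v p, 1:] ^ (r + 1):] dvd f"
      using assms(4) by (simp_all add: line_ideal_def line_poly_def poly_const_pow del: power_Suc)
    from split_outer[OF assms(3,2) this] show ?thesis
      using True
      by (simp add: line_ideal_def line_poly_def poly_const_pow del: power_Suc) metis
  next
    case False
    then have "f \<in> bideg_space m m'" "[:[:- axis_coord v p:], 1:] ^ (r' + 1) dvd f"
      using assms(4) by (simp_all add: line_ideal_def line_poly_def del: power_Suc)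
    from split_inner[OF assms(3,1) this] show ?thesis
      using False
      by (simp add: line_ideal_def line_poly_def poly_const_pow del: power_Suc) metis
  qed
  then obtain g where g: "g \<in> line_ideal m m' r r' v p" "g \<in> line_ideal m m' r r' (\<not> v) p"
    "line_poly (\<not> v) (axis_coord (\<not> v) q) ^ ((if \<not> v then r else r') + 1) dvd f - g"
    by blast
  moreover have "f - g \<in> bideg_space m m'"
    using line_ideal_diff[OF assms(4) g(1)] by (simp add: line_ideal_def)
  ultimately show ?thesis
    using that by (simp add: line_ideal_def)
qed


section \<open>Boundaries of edge chains\<close>

text \<open>This is the chain \<open>[\<gamma>]f\<close>, with the convention that
  \<open>[\<gamma>]\<close> is zero outside \<open>D\<close>, which will be the interior of the
  domain.\<close>

definition point_chain :: "point set \<Rightarrow> point \<Rightarrow> bipoly \<Rightarrow> point \<Rightarrow> bipoly" where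
  "point_chain D \<gamma> f = (\<lambda>x. if x = \<gamma> \<and> \<gamma> \<in> D then f else 0)"

text \<open>The group generated by the boundaries of single edges, independent of orientations: the
  ends may be listed in either order. An edge with no end in \<open>D\<close> contributes only
  zero.\<close>

inductive_set edge_span ::
    "point set \<Rightarrow> (point set \<Rightarrow> bipoly set) \<Rightarrow> point set set \<Rightarrow> (point \<Rightarrow> bipoly) set"
  for D I E where
  edge: "\<tau> \<in> E \<Longrightarrow> rel_frontier \<tau> = {a, b} \<Longrightarrow> f \<in> I \<tau> \<Longrightarrow>
    point_chain D b f - point_chain D a f \<in> edge_span D I E"
| zero: "0 \<in> edge_span D I E"
| diff: "v \<in> edge_span D I E \<Longrightarrow> w \<in> edge_span D I E \<Longrightarrow> v - w \<in> edge_span D I E"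

lemma edge_span_add:
  assumes "v \<in> edge_span D I E" "w \<in> edge_span D I E"
  shows "v + w \<in> edge_span D I E"
  using edge_span.diff[OF assms(1) edge_span.diff[OF edge_span.zero assms(2)]] by simp

text \<open>This rule and the next transport the vanishing of a class from one end of an edge to the
  other, in either direction.\<close>

lemma edge_span_diffD1: "v - w \<in> edge_span D I E \<Longrightarrow> w \<in> edge_span D I E \<Longrightarrow> v \<in> edge_span D I E"
  using edge_span_add[of "v - w" D I E w] by (simp only: diff_add_cancel)

lemma edge_span_diffD2: "v - w \<in> edge_span D I E \<Longrightarrow> v \<in> edge_span D I E \<Longrightarrow> w \<in> edge_span D I E"
  using edge_span.diff[of v D I E "v - w"] by (simp only: diff_diff_eq2 add_diff_cancel_left')

lemma edge_span_sum:
  assumes "\<And>x. x \<in> A \<Longrightarrow> f x \<in> edge_span D I E"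
  shows "sum f A \<in> edge_span D I E"
  using assms by (induction A rule: infinite_finite_induct) (auto intro: edge_span.zero edge_span_add)

lemma edge_span_mono:
  assumes "w \<in> edge_span D I E" "E \<subseteq> E'"
  shows "w \<in> edge_span D I E'"
  using assms by induction (auto intro: edge_span.intros)

lemma point_chain_add: "point_chain D \<gamma> (f + g) = point_chain D \<gamma> f + point_chain D \<gamma> g"
  by (auto simp: point_chain_def)

lemma point_chain_outside: "\<gamma> \<notin> D \<Longrightarrow> point_chain D \<gamma> f = 0"
  by (auto simp: point_chain_def)

lemma sum_fun_apply: "(\<Sum>i\<in>A. f i) x = (\<Sum>i\<in>A. f i x)"
  for f :: "'i \<Rightarrow> 'a \<Rightarrow> 'b::comm_monoid_add"
  by (induction A rule: infinite_finite_induct) auto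

section \<open>Vanishing classes under subdivision and cutting\<close>

context
  fixes m m' r r' :: nat and D :: "point set"
begin

abbreviation chain_span :: "point set set \<Rightarrow> (point \<Rightarrow> bipoly) set" where
  "chain_span \<equiv> edge_span D (edge_ideal m m' (constant_smoothness r r'))"

text \<open>The classes \<open>[\<gamma>]f\<close> with \<open>f\<close> in the given line ideal vanish in the cokernel.\<close>

definition null_at :: "point set set \<Rightarrow> bool \<Rightarrow> point \<Rightarrow> bool" where
  "null_at E v \<gamma> \<longleftrightarrow> (\<forall>f\<in>line_ideal m m' r r' v \<gamma>. point_chain D \<gamma> f \<in> chain_span E)"

text \<open>The boundary telescopes as \<open>([b]f - [p]f) - ([a]f - [p]f)\<close>, and both halves
  have the ideal of the whole edge since they lie on the same line.\<close>

lemma edge_span_subdivide: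
  assumes "w \<in> chain_span E" "\<forall>\<tau>\<in>E. \<exists>v. parallel v \<tau>"
  shows "w \<in> chain_span (subdivide p E)"
  using assms(1)
proof induction
  case (edge \<tau> a b f)
  show ?case
  proof (cases "p \<in> rel_interior \<tau>")
    case True
    obtain v where v: "parallel v \<tau>"
      using assms(2) edge(1) by blast
    have *: "point_chain D e f - point_chain D p f \<in> chain_span (subdivide p E)" if "e \<in> {a, b}" for e
    proof (rule edge_span.edge)
      have e: "e \<in> rel_frontier \<tau>"
        using that edge(2) by simp
      note half = parallel_half[OF v True e]
      show "closed_segment e p \<in> subdivide p E"
        using edge(1) True e unfolding subdivide_def by blast
      show "rel_frontier (closed_segment e p) = {p, e}"
        using half(3) by auto
      show "f \<in> edge_ideal m m' (constant_smoothness r r') (closed_segment e p)"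
        using edge(3) half(2) edge_ideal_eq[OF half(1), of e] edge_ideal_eq[OF v, of e] by auto
    qed
    show ?thesis
      using edge_span.diff[OF *[of b] *[of a]] by (simp only: insert_iff simp_thms diff_diff_eq2 diff_add_cancel)
  next
    case False
    then show ?thesis
      using edge by (intro edge_span.edge) (auto simp: subdivide_def)
  qed
qed (blast intro: edge_span.zero edge_span.diff)+

lemma null_at_subdivide_old:
  assumes "null_at E v \<gamma>" "\<forall>\<tau>\<in>E. \<exists>v. parallel v \<tau>"
  shows "null_at (subdivide p E) v \<gamma>"
  using assms edge_span_subdivide by (simp add: null_at_def)

text \<open>If \<open>p\<close> is not an end of \<tau>, the half of \<tau> from \<open>a\<close> to
  \<open>p\<close> carries the class at \<open>p\<close> to the old vertex \<open>a\<close>, where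
  the line ideal is the same and the class already vanishes.\<close>

lemma null_at_subdivide_new:
  assumes E: "\<forall>\<tau>\<in>E. \<exists>v. parallel v \<tau>" and \<tau>: "\<tau> \<in> E" "parallel v \<tau>" "p \<in> \<tau>"
    and null: "\<And>\<gamma>. \<gamma> \<in> \<Union> (rel_frontier ` E) \<Longrightarrow> null_at E v \<gamma>"
  shows "null_at (subdivide p E) v p"
proof (cases "p \<in> rel_frontier \<tau>")
  case True
  then show ?thesis
    using \<tau>(1) null null_at_subdivide_old[OF _ E] by blast
next
  case False
  obtain a b where ab: "\<tau> = closed_segment a b" "rel_frontier \<tau> = {a, b}"
    "rel_interior \<tau> = \<tau> - {a, b}"
    using parallel_rel_frontier[OF \<tau>(2)] by metis
  have p: "p \<in> rel_interior \<tau>" and a: "a \<in> rel_frontier \<tau>"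
    using False \<tau>(3) ab by auto
  note half = parallel_half[OF \<tau>(2) p a]
  show ?thesis
    unfolding null_at_def
  proof
    fix f assume f: "f \<in> line_ideal m m' r r' v p"
    have "axis_coord v p = axis_coord v a"
      using parallel_axis_coord[OF half(1)] ends_in_segment by blast
    then have "f \<in> line_ideal m m' r r' v a"
      using f line_ideal_cong by blast
    then have "point_chain D a f \<in> chain_span (subdivide p E)"
      using null_at_subdivide_old[OF null E] \<tau>(1) a unfolding null_at_def by blast
    moreover have "point_chain D p f - point_chain D a f \<in> chain_span (subdivide p E)"
    proof (rule edge_span.edge)
      show "closed_segment a p \<in> subdivide p E"
        using \<tau>(1) p a unfolding subdivide_def by blast
      show "f \<in> edge_ideal m m' (constant_smoothness r r') (closed_segment a p)"
        using f edge_ideal_eq[OF half(1), of p] by auto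
    qed (rule half(3))
    ultimately show "point_chain D p f \<in> chain_span (subdivide p E)"
      by (rule edge_span_diffD1[rotated])
  qed
qed

lemma null_at_split:
  assumes "m \<ge> 2 * r + 1" "m' \<ge> 2 * r' + 1"
    and E: "\<forall>\<tau>\<in>E. \<exists>v. parallel v \<tau>"
    and S: "parallel v S" "rel_frontier S = {p, q}"
    and E': "E' = insert S (subdivide q (subdivide p E))"
    and null: "\<And>w \<gamma>. \<gamma> \<in> \<Union> (rel_frontier ` E) \<Longrightarrow> null_at E w \<gamma>"
    and perp: "\<exists>\<tau>\<in>E'. parallel (\<not> v) \<tau> \<and> p \<in> \<tau>" "\<exists>\<tau>\<in>E'. parallel (\<not> v) \<tau> \<and> q \<in> \<tau>"
    and \<gamma>: "\<gamma> \<in> \<Union> (rel_frontier ` E')"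
  shows "null_at E' w \<gamma>"
proof -
  let ?E1 = "subdivide p E" and ?E2 = "subdivide q (subdivide p E)"
  have E1: "\<forall>\<tau>\<in>?E1. \<exists>v. parallel v \<tau>"
    using parallel_subdivide[OF E] .
  have null': "null_at E' w \<gamma>" if "null_at ?E2 w \<gamma>" for w \<gamma>
    using that unfolding null_at_def E' by (auto intro: edge_span_mono)
  have old: "null_at E' w \<gamma>" if "\<gamma> \<in> \<Union> (rel_frontier ` E)" for w \<gamma>
    by (intro null' null_at_subdivide_old null E E1 that)
  \<comment> \<open>Hence the perpendicular edges through \<open>p\<close> and \<open>q\<close>
    differ from the cut and descend from edges that existed before it.\<close>
  have notS: "\<not> parallel (\<not> v) S"
    using S(1) parallel_not_both by blast
  have perp1: "\<exists>\<tau>\<in>?E1. parallel (\<not> v) \<tau> \<and> e \<in> \<tau>" if e: "e = p \<or> e = q" for e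
  proof -
    obtain \<tau>' where \<tau>': "\<tau>' \<in> E'" "parallel (\<not> v) \<tau>'" "e \<in> \<tau>'"
      using perp e by metis
    then have "\<tau>' \<in> ?E2"
      using notS unfolding E' by (metis insertE)
    from subdivide_parallel_parent[OF E1 this \<tau>'(2)] show ?thesis
      using \<tau>'(3) by (metis subsetD)
  qed
  obtain \<tau>1 where \<tau>1: "\<tau>1 \<in> ?E1" "parallel (\<not> v) \<tau>1" "p \<in> \<tau>1"
    using perp1[of p] by auto
  obtain \<tau> where \<tau>: "\<tau> \<in> E" "parallel (\<not> v) \<tau>" "\<tau>1 \<subseteq> \<tau>"
    by (rule subdivide_parallel_parent[OF E \<tau>1(1,2)])
  have p1: "null_at ?E1 (\<not> v) p"
    by (rule null_at_subdivide_new[OF E \<tau>(1,2) subsetD[OF \<tau>(3) \<tau>1(3)] null])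
  \<comment> \<open>The subdivision at \<open>q\<close> starts from \<open>?E1\<close>, which may
    have \<open>p\<close> as a vertex. At \<open>p\<close> only the direction
    \<open>\<not> v\<close> is settled so far; direction \<open>v\<close> has to wait for the
    cut.\<close>
  have E1_null: "null_at ?E1 (\<not> v) \<gamma>" if "\<gamma> \<in> \<Union> (rel_frontier ` ?E1)" for \<gamma>
    using subsetD[OF rel_frontier_subdivide[OF E] that]
  proof (rule insertE)
    assume "\<gamma> \<in> \<Union> (rel_frontier ` E)"
    then show ?thesis
      by (intro null_at_subdivide_old[OF _ E] null)
  qed (simp add: p1)
  obtain \<tau>2 where \<tau>2: "\<tau>2 \<in> ?E1" "parallel (\<not> v) \<tau>2" "q \<in> \<tau>2"
    using perp1[of q] by auto
  have "null_at ?E2 (\<not> v) q"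
    by (rule null_at_subdivide_new[OF E1 \<tau>2 E1_null])
  then have nq: "null_at E' (\<not> v) q" and np: "null_at E' (\<not> v) p"
    using null' null_at_subdivide_old[OF p1 E1] by auto
  obtain a b where "a \<noteq> b" "S = closed_segment a b" "{p, q} = {a, b}"
    using parallel_rel_frontier[OF S(1)] S(2) by metis
  then have pq: "p \<in> S" "q \<in> S" "p \<noteq> q"
    by auto
  then have coord: "axis_coord v p = axis_coord v q"
    using parallel_axis_coord[OF S(1)] by blast
  \<comment> \<open>So the perpendicular lines through the two ends of the cut are distinct, as the
    splitting requires.\<close>
  then have coord': "axis_coord (\<not> v) p \<noteq> axis_coord (\<not> v) q"
    using pq(3) by (auto simp: axis_coord_def prod_eq_iff split: if_splits)
  have swap: "point_chain D q f - point_chain D p f \<in> chain_span E'" if "f \<in> line_ideal m m' r r' v p" for f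
    using that S edge_ideal_eq[OF S(1) pq(1)] unfolding E' by (intro edge_span.edge) auto
  \<comment> \<open>The cut moves a multiple of its ideal from one end to the other, so the part of \<open>f\<close> that
    vanishes along the edge through \<open>q\<close> can be disposed of at \<open>q\<close>.\<close>
  have vp: "null_at E' v p"
    unfolding null_at_def
  proof
    fix f assume f: "f \<in> line_ideal m m' r r' v p"
    then obtain g where g: "g \<in> line_ideal m m' r r' v p" "g \<in> line_ideal m m' r r' (\<not> v) p"
      "f - g \<in> line_ideal m m' r r' (\<not> v) q"
      using line_ideal_split[OF assms(1,2) coord' f] by blast
    have "point_chain D q (f - g) \<in> chain_span E'"
      using nq g(3) unfolding null_at_def by blast
    then have "point_chain D p (f - g) \<in> chain_span E'"
      by (rule edge_span_diffD2[OF swap[OF line_ideal_diff[OF f g(1)]]])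
    moreover have "point_chain D p g \<in> chain_span E'"
      using np g(2) unfolding null_at_def by blast
    ultimately have "point_chain D p (f - g + g) \<in> chain_span E'"
      unfolding point_chain_add by (rule edge_span_add)
    then show "point_chain D p f \<in> chain_span E'"
      by simp
  qed
  \<comment> \<open>Once \<open>p\<close> is settled, every element of the ideal of the cut can be
    moved from \<open>q\<close> to \<open>p\<close> along \<open>S\<close>.\<close>
  have vq: "null_at E' v q"
    unfolding null_at_def
  proof
    fix f assume "f \<in> line_ideal m m' r r' v q"
    then have f: "f \<in> line_ideal m m' r r' v p"
      using line_ideal_cong[OF coord] by blast
    then have "point_chain D p f \<in> chain_span E'"
      using vp unfolding null_at_def by blast
    then show "point_chain D q f \<in> chain_span E'"
      by (rule edge_span_diffD1[OF swap[OF f]])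
  qed
  have "\<gamma> \<in> {p, q} \<union> \<Union> (rel_frontier ` E)"
  proof -
    have "\<gamma> \<in> {p, q} \<union> \<Union> (rel_frontier ` ?E2)"
      using \<gamma> S(2) unfolding E' by simp
    also have "\<dots> \<subseteq> {p, q} \<union> insert q (insert p (\<Union> (rel_frontier ` E)))"
      by (rule Un_mono[OF order_refl order.trans[OF rel_frontier_subdivide[OF E1]
            insert_mono[OF rel_frontier_subdivide[OF E]]]])
    finally show ?thesis
      by blast
  qed
  then consider "\<gamma> = p \<or> \<gamma> = q" | "\<gamma> \<in> \<Union> (rel_frontier ` E)"
    by blast
  then show ?thesis
  proof cases
    case 1
    then show ?thesis
      using vp vq np nq by (cases "w = v") auto
  next
    case 2
    then show ?thesis
      by (rule old)
  qed
qed

end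

section \<open>Induction over the splits of a mesh\<close>

lemma tmesh_parallel:
  assumes "tmesh T" "\<tau> \<in> edges T"
  shows "\<exists>v. parallel v \<tau>"
  using assms unfolding tmesh_def parallel_def by metis

lemma parallel_rel_frontier_subset: "parallel v \<tau> \<Longrightarrow> rel_frontier \<tau> \<subseteq> \<tau>"
  by (metis parallel_rel_frontier ends_in_segment empty_subsetI insert_subset)

lemma tmesh_vertex_on_parallel:
  assumes "tmesh T" "\<gamma> \<in> vertices T"
  shows "\<exists>\<tau>\<in>edges T. parallel v \<tau> \<and> \<gamma> \<in> \<tau>"
  using assms unfolding tmesh_def parallel_def by (cases v) auto

lemma hierarchical_tmesh_tmesh: "hierarchical_tmesh T \<Longrightarrow> tmesh T"
  by (auto elim: hierarchical_tmesh.cases)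

text \<open>A split thus leaves the domain unchanged, so the same set \<open>D\<close> serves before
  and after it.\<close>

lemma cuts_union: "cuts \<sigma> S \<sigma>1 \<sigma>2 \<Longrightarrow> \<sigma>1 \<union> \<sigma>2 = \<sigma>"
  unfolding cuts_def by force

lemma hierarchical_null_at:
  assumes "hierarchical_tmesh T" "m \<ge> 2 * r + 1" "m' \<ge> 2 * r' + 1" "\<gamma> \<in> vertices T"
  shows "null_at m m' r r' (interior (domain T)) (edges T) v \<gamma>"
  using assms(1,4)
proof (induction arbitrary: v \<gamma>)
  case (single T \<sigma>)
  then obtain \<tau> where \<tau>: "\<tau> \<in> edges T" "\<gamma> \<in> rel_frontier \<tau>"
    by (auto simp: vertices_def)
  then have "\<gamma> \<in> \<tau>"
    using tmesh_parallel[OF single(1)] parallel_rel_frontier_subset by blast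
  \<comment> \<open>All edges lie on the frontier of the only cell; there are no interior vertices
    and every class at a vertex is zero.\<close>
  then have "\<gamma> \<in> frontier \<sigma>"
    using single(1,2) \<tau>(1) unfolding tmesh_def by auto
  then have "\<gamma> \<notin> interior (domain T)"
    by (simp add: domain_def single frontier_def)
  then show ?case
    by (simp add: null_at_def point_chain_outside edge_span.zero)
next
  case (split T T')
  from split.hyps(2)[unfolded splits_to_def] obtain \<sigma> S \<sigma>1 \<sigma>2 p q where s: "\<sigma> \<in> cells T" "cuts \<sigma> S \<sigma>1 \<sigma>2" "rel_frontier S = {p, q}"
    "cells T' = (cells T - {\<sigma>}) \<union> {\<sigma>1, \<sigma>2}"
    "edges T' = insert S (subdivide q (subdivide p (edges T)))"
    by (elim bexE exE conjE) (rule that)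
  have dom: "domain T' = domain T"
    using s(1,4) cuts_union[OF s(2)] unfolding domain_def by blast
  have S: "S \<in> edges T'"
    using s(5) by simp
  obtain d where d: "parallel d S"
    using tmesh_parallel[OF split.hyps(3) S] by blast
  \<comment> \<open>The standing assumption on the new mesh supplies an edge perpendicular to the
    cut at each of its ends.\<close>
  have "p \<in> vertices T'" "q \<in> vertices T'"
    using S s(3) unfolding vertices_def by blast+
  note perp = this[THEN tmesh_vertex_on_parallel[OF split.hyps(3), where v = "\<not> d"]]
  show ?case
    unfolding dom
  proof (rule null_at_split[OF assms(2,3) _ d s(3,5) _ perp])
    show "\<forall>\<tau>\<in>edges T. \<exists>v. parallel v \<tau>"
      using tmesh_parallel hierarchical_tmesh_tmesh[OF split.hyps(1)] by blast
    show "null_at m m' r r' (interior (domain T)) (edges T) w \<delta>"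
      if "\<delta> \<in> \<Union> (rel_frontier ` edges T)" for w \<delta>
      using split.IH[of \<delta> w] that by (simp add: vertices_def)
    show "\<gamma> \<in> \<Union> (rel_frontier ` edges T')"
      using split.prems by (simp add: vertices_def)
  qed
qed

section \<open>The image of the boundary map\<close>

lemma tmesh_edge_ideal:
  assumes "tmesh T" "\<tau> \<in> edges T"
  shows zero_in_edge_ideal: "0 \<in> edge_ideal m m' (constant_smoothness r r') \<tau>"
    and edge_ideal_diff: "f \<in> edge_ideal m m' (constant_smoothness r r') \<tau> \<Longrightarrow>
      g \<in> edge_ideal m m' (constant_smoothness r r') \<tau> \<Longrightarrow>
      f - g \<in> edge_ideal m m' (constant_smoothness r r') \<tau>"
proof -
  obtain v where v: "parallel v \<tau>"
    using tmesh_parallel[OF assms] by blast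
  then obtain \<gamma> where "\<gamma> \<in> \<tau>"
    unfolding parallel_iff by auto
  \<comment> \<open>In \<open>edge_ideal\<close> the polynomial \<open>l\<close> may vary with the
    element; the line ideal has a fixed generator, which makes closure under differences
    evident.\<close>
  note eq = edge_ideal_eq[OF v this]
  show "0 \<in> edge_ideal m m' (constant_smoothness r r') \<tau>"
    unfolding eq by (rule zero_in_line_ideal)
  show "f - g \<in> edge_ideal m m' (constant_smoothness r r') \<tau>"
    if "f \<in> edge_ideal m m' (constant_smoothness r r') \<tau>"
      "g \<in> edge_ideal m m' (constant_smoothness r r') \<tau>"
    using that unfolding eq by (rule line_ideal_diff)
qed

lemma zero_in_boundary1_image:
  assumes "tmesh T"
  shows "0 \<in> boundary1 T ori ` edge_chains T m m' (constant_smoothness r r')"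
proof
  show "0 = boundary1 T ori 0"
    by (auto simp: boundary1_def zero_fun_def intro!: sum.neutral)
  show "0 \<in> edge_chains T m m' (constant_smoothness r r')"
    using zero_in_edge_ideal[OF assms] by (auto simp: edge_chains_def interior_edges_def)
qed

lemma boundary1_image_diff:
  assumes T: "tmesh T"
    and "x \<in> boundary1 T ori ` edge_chains T m m' (constant_smoothness r r')"
    and "y \<in> boundary1 T ori ` edge_chains T m m' (constant_smoothness r r')"
  shows "x - y \<in> boundary1 T ori ` edge_chains T m m' (constant_smoothness r r')"
proof -
  obtain f g where fg: "x = boundary1 T ori f" "f \<in> edge_chains T m m' (constant_smoothness r r')"
    "y = boundary1 T ori g" "g \<in> edge_chains T m m' (constant_smoothness r r')"
    using assms(2,3) by auto
  have "x - y = boundary1 T ori (f - g)"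
    by (auto simp: fg boundary1_def fun_eq_iff simp flip: sum_subtractf intro!: sum.cong)
  moreover have "f - g \<in> edge_chains T m m' (constant_smoothness r r')"
    using fg(2,4) edge_ideal_diff[OF T] by (auto simp: edge_chains_def interior_edges_def)
  ultimately show ?thesis
    by (rule image_eqI)
qed

text \<open>Every generator is, up to sign, the boundary of a chain supported on one interior edge,
  or zero; the image is closed under differences.\<close>

lemma edge_span_subset_image:
  assumes T: "tmesh T" and ori: "orientation T ori"
    and w: "w \<in> edge_span (interior (domain T)) (edge_ideal m m' (constant_smoothness r r')) (edges T)"
  shows "w \<in> boundary1 T ori ` edge_chains T m m' (constant_smoothness r r')" (is "w \<in> ?B")
proof -
  note zero = zero_in_boundary1_image[OF T, of ori m m' r r']
  note diff = boundary1_image_diff[OF T, of _ ori m m' r r']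
  show ?thesis
    using w
  proof induction
    case (edge \<tau> a b f)
    show ?case (is "?x \<in> _")
    proof (cases "\<tau> \<in> interior_edges T")
      case False
      \<comment> \<open>An edge missing the interior of the domain has no end there, so both point
        chains vanish.\<close>
      have "a \<in> \<tau>" "b \<in> \<tau>"
        using edge(1,2) tmesh_parallel[OF T] parallel_rel_frontier_subset by blast+
      then have "a \<notin> interior (domain T)" "b \<notin> interior (domain T)"
        using False edge(1) by (auto simp: interior_edges_def)
      then show ?thesis
        using zero by (simp only: point_chain_outside diff_self not_False_eq_True)
    next
      case True
      let ?f = "\<lambda>\<sigma>. if \<sigma> = \<tau> then f else 0"
      have vert: "a \<in> vertices T" "b \<in> vertices T"
        using edge(1,2) by (auto simp: vertices_def)
      have fin: "finite (interior_edges T)"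
        using T by (auto simp: tmesh_def interior_edges_def)
      have sum: "(\<Sum>\<sigma>\<in>interior_edges T. (if snd (ori \<sigma>) = \<gamma> then ?f \<sigma> else 0)
          - (if fst (ori \<sigma>) = \<gamma> then ?f \<sigma> else 0))
          = (if snd (ori \<tau>) = \<gamma> then f else 0) - (if fst (ori \<tau>) = \<gamma> then f else 0)"
        (is "sum ?h _ = _") for \<gamma>
      proof -
        have "sum ?h (interior_edges T - {\<tau>}) = 0"
          by (rule sum.neutral) simp
        then show ?thesis
          using sum.remove[OF fin True, of ?h] by simp
      qed
      have f: "?f \<in> edge_chains T m m' (constant_smoothness r r')"
        using True edge(1,3) zero_in_edge_ideal[OF T] by (auto simp: edge_chains_def interior_edges_def)
      have "{fst (ori \<tau>), snd (ori \<tau>)} = {a, b}"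
        using ori edge(1,2) by (auto simp: orientation_def)
      then consider "fst (ori \<tau>) = a" "snd (ori \<tau>) = b" | "fst (ori \<tau>) = b" "snd (ori \<tau>) = a"
        by (auto simp: doubleton_eq_iff)
      then show ?thesis
      proof cases
        case 1
        then have "?x = boundary1 T ori ?f"
          unfolding boundary1_def sum using vert
          by (auto simp: fun_eq_iff point_chain_def interior_vertices_def)
        then show ?thesis
          using f by (rule image_eqI)
      next
        case 2
        \<comment> \<open>The given orientation runs against the order of \<open>a\<close> and
          \<open>b\<close>, which costs a sign.\<close>
        then have "?x = 0 - boundary1 T ori ?f"
          unfolding boundary1_def sum using vert
          by (auto simp: fun_eq_iff point_chain_def interior_vertices_def)
        then show ?thesis
          using diff[OF zero imageI[OF f]] by (simp only:)
      qed
    qed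
  qed (rule zero, rule diff)
qed

text \<open>A vertex chain is the finite sum of its values placed at single vertices, and each value
  is a sum of elements of the two line ideals at that vertex.\<close>

lemma vertex_chains_subset_span:
  assumes T: "tmesh T"
    and null: "\<And>v \<gamma>. \<gamma> \<in> vertices T \<Longrightarrow> null_at m m' r r' (interior (domain T)) (edges T) v \<gamma>"
    and g: "g \<in> vertex_chains T m m' (constant_smoothness r r')"
  shows "g \<in> edge_span (interior (domain T)) (edge_ideal m m' (constant_smoothness r r')) (edges T)"
    (is "g \<in> ?W")
proof -
  let ?D = "interior (domain T)"
  have "finite (rel_frontier \<tau>)" if "\<tau> \<in> edges T" for \<tau>
    using tmesh_parallel[OF T that] by (metis parallel_rel_frontier finite.emptyI finite_insert)
  then have fin: "finite (interior_vertices T)"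
    using T by (auto simp: interior_vertices_def vertices_def tmesh_def)
  have outside: "g x = 0" if "x \<notin> interior_vertices T" for x
    using g that unfolding vertex_chains_def by blast
  have "point_chain ?D \<gamma> (g \<gamma>) \<in> ?W" if \<gamma>: "\<gamma> \<in> interior_vertices T" for \<gamma>
  proof -
    have "g \<gamma> \<in> vertex_ideal T m m' (constant_smoothness r r') \<gamma>"
      using g \<gamma> by (auto simp: vertex_chains_def)
    then obtain p q \<tau>v \<tau>h where pq: "g \<gamma> = p + q" "parallel True \<tau>v" "\<gamma> \<in> \<tau>v"
      "p \<in> edge_ideal m m' (constant_smoothness r r') \<tau>v" "parallel False \<tau>h" "\<gamma> \<in> \<tau>h"
      "q \<in> edge_ideal m m' (constant_smoothness r r') \<tau>h"
      unfolding vertex_ideal_def parallel_def by auto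
    then have "p \<in> line_ideal m m' r r' True \<gamma>" "q \<in> line_ideal m m' r r' False \<gamma>"
      using edge_ideal_eq by blast+
    then have "point_chain ?D \<gamma> p \<in> ?W" "point_chain ?D \<gamma> q \<in> ?W"
      using null \<gamma> by (auto simp: null_at_def interior_vertices_def)
    then show ?thesis
      by (simp add: pq(1) point_chain_add edge_span_add)
  qed
  then have "(\<Sum>\<gamma>\<in>interior_vertices T. point_chain ?D \<gamma> (g \<gamma>)) \<in> ?W"
    by (rule edge_span_sum)
  moreover have "(\<Sum>\<gamma>\<in>interior_vertices T. point_chain ?D \<gamma> (g \<gamma>)) = g"
  proof
    fix x
    have "(\<Sum>\<gamma>\<in>interior_vertices T. point_chain ?D \<gamma> (g \<gamma>) x)
        = (\<Sum>\<gamma>\<in>interior_vertices T. if \<gamma> = x then g x else 0)"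
      by (rule sum.cong) (auto simp: point_chain_def interior_vertices_def)
    also have "\<dots> = g x"
      using fin outside[of x] by auto
    finally show "(\<Sum>\<gamma>\<in>interior_vertices T. point_chain ?D \<gamma> (g \<gamma>)) x = g x"
      by (simp add: sum_fun_apply)
  qed
  ultimately show ?thesis
    by simp
qed

text \<open>The empty set is a quotient basis. Because of \<open>THE\<close>, it must also be shown
  that every quotient basis is empty; this follows from the uniqueness of the coefficients that
  represent 0.\<close>

lemma quotient_dim_eq_0:
  assumes V: "V \<subseteq> W" "0 \<in> V" and W: "\<And>x y. x \<in> W \<Longrightarrow> y \<in> W \<Longrightarrow> x - y \<in> W"
    and scl: "\<And>a v. scl (a + 1) v = scl a v + v"
  shows "quotient_dim scl V W = 0"
  unfolding quotient_dim_def
proof (rule the_equality)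
  have "quotient_basis scl V W {}"
    using V by (auto simp: quotient_basis_def)
  then show "\<exists>B. quotient_basis scl V W B \<and> card B = 0"
    by (intro exI[of _ "{}"]) simp
next
  fix n
  assume "\<exists>B. quotient_basis scl V W B \<and> card B = n"
  then obtain B where "quotient_basis scl V W B" and n: "card B = n"
    by blast
  let ?P = "\<lambda>c. (\<forall>b. b \<notin> B \<longrightarrow> c b = 0) \<and> 0 - (\<Sum>b\<in>B. scl (c b) b) \<in> W"
  have B: "finite B" "B \<subseteq> V" "\<exists>!c. ?P c"
    using \<open>quotient_basis scl V W B\<close> V(2) unfolding quotient_basis_def by blast+
  then obtain c where c: "\<forall>b. b \<notin> B \<longrightarrow> c b = 0" "0 - (\<Sum>b\<in>B. scl (c b) b) \<in> W"
    and unique: "\<And>c'. ?P c' \<Longrightarrow> c' = c"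
    by (elim ex1E) blast
  have "B = {}"
  proof (rule ccontr)
    assume "B \<noteq> {}"
    then obtain b where b: "b \<in> B" by blast
    \<comment> \<open>Raising one coefficient by 1 changes the sum by \<open>b\<close>, which lies
      in \<open>W\<close>, and so gives a second representation of 0.\<close>
    let ?c = "c(b := c b + 1)"
    have "(\<Sum>x\<in>B. scl (?c x) x) = (\<Sum>x\<in>B. scl (c x) x) + b"
      using B(1) b by (simp add: sum.remove[of _ b] scl)
    then have "0 - (\<Sum>x\<in>B. scl (?c x) x) = 0 - (\<Sum>x\<in>B. scl (c x) x) - b"
      by simp
    then have "0 - (\<Sum>x\<in>B. scl (?c x) x) \<in> W"
      using W[OF c(2)] b B(2) V(1) by (simp add: subset_iff)
    moreover have "\<forall>x. x \<notin> B \<longrightarrow> ?c x = 0"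
      using b c(1) by auto
    ultimately have "?c = c"
      by (intro unique conjI)
    then show False
      by (metis fun_upd_same add_cancel_right_right zero_neq_one)
  qed
  then show "n = 0"
    using n B(1) by simp
qed

theorem proposition4p3:
  fixes T :: mesh and ori :: "point set \<Rightarrow> point \<times> point" and r r' m m' :: nat
  assumes "hierarchical_tmesh T"
    and "orientation T ori"
    and "m \<ge> 2 * r + 1" and "m' \<ge> 2 * r' + 1"
  shows "h_dim T ori (constant_smoothness r r') m m' = 0"
proof -
  have T: "tmesh T"
    using assms(1) by (rule hierarchical_tmesh_tmesh)
  have null: "null_at m m' r r' (interior (domain T)) (edges T) v \<gamma>" if "\<gamma> \<in> vertices T" for v \<gamma>
    using hierarchical_null_at assms(1,3,4) that .
  show ?thesis
    unfolding h_dim_def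
  proof (rule quotient_dim_eq_0)
    show "vertex_chains T m m' (constant_smoothness r r')
        \<subseteq> boundary1 T ori ` edge_chains T m m' (constant_smoothness r r')"
      using edge_span_subset_image[OF T assms(2)] vertex_chains_subset_span[OF T null] by blast
    \<comment> \<open>By its form \<open>vertex_ideal\<close> would be empty at a point lacking an
      edge of either direction; the standing assumption excludes this.\<close>
    have "0 \<in> vertex_ideal T m m' (constant_smoothness r r') \<gamma>" if \<gamma>: "\<gamma> \<in> vertices T" for \<gamma>
    proof -
      obtain \<tau>v \<tau>h where "\<tau>v \<in> edges T" "vertical \<tau>v" "\<gamma> \<in> \<tau>v"
        "\<tau>h \<in> edges T" "horizontal \<tau>h" "\<gamma> \<in> \<tau>h"
        using tmesh_vertex_on_parallel[OF T \<gamma>, of True] tmesh_vertex_on_parallel[OF T \<gamma>, of False]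
        by (auto simp: parallel_def)
      then show ?thesis
        unfolding vertex_ideal_def using zero_in_edge_ideal[OF T] add_0[of 0, symmetric] by blast
    qed
    then show "0 \<in> vertex_chains T m m' (constant_smoothness r r')"
      by (simp add: vertex_chains_def interior_vertices_def)
    show "x - y \<in> boundary1 T ori ` edge_chains T m m' (constant_smoothness r r')"
      if "x \<in> boundary1 T ori ` edge_chains T m m' (constant_smoothness r r')"
        "y \<in> boundary1 T ori ` edge_chains T m m' (constant_smoothness r r')" for x y
      using boundary1_image_diff[OF T that] .
    have "[:a + 1:] = [:a:] + 1" for a :: real
      by (simp add: one_pCons)
    then show "chain_scale (a + 1) v = chain_scale a v + v" for a v
      by (simp add: chain_scale_def fun_eq_iff smult_add_left)
  qed
qed

end
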